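(* Let $f:\mathbb{R}\to\mathbb{R}$ be continuous with $\lim_{|x|\to\infty} f(x)/x=0$, let $k=(k(n))_{n\ge 0}$ be a real sequence with $\sum_{j=0}^\infty |k(j)|<+\infty$, let $(H(n))_{n\ge 1}$ be a real sequence, let $\xi\in\mathbb{R}$, and let $(x(n))_{n\ge 0}$ be the real sequence defined by $x(0)=\xi$ and $$x(n+1)=H(n+1)+\sum_{j=0}^n k(n-j)f(x(j)),\quad n\ge 0.$$ Let $\varphi:[0,\infty)\to[0,\infty)$ be an increasing convex function. (i) If there exists $\eta>0$ such that $$\limsup_{n\to\infty}\frac1n\sum_{j=1}^n\varphi\big((1+\eta)|H(j)|\big)<+\infty,$$ then $$\limsup_{n\to\infty}\frac1n\sum_{j=0}^n\varphi\big(|x(j)|\big)<+\infty.$$ (ii) If there exists $\eta>0$ such that $$\limsup_{n\to\infty}\frac1n\sum_{j=0}^n\varphi\big((1+\eta)|x(j)|\big)<+\infty,$$ then $$\limsup_{n\to\infty}\frac1n\sum_{j=1}^n\varphi\big(|H(j)|\big)<+\infty.$$ *)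

theory Defs
  imports "HOL-Analysis.Analysis"
begin

end

theory Submission
  imports Defs
begin

text \<open>
  Both parts are instances of one estimate. Sublinearity and continuity of \<open>f\<close> give
  \<open>\<bar>f t\<bar> \<le> M + \<epsilon> * \<bar>t\<bar>\<close> for every \<open>t\<close>, with \<open>\<epsilon> > 0\<close> as small as one likes
  (\<open>sublinear_affine_bound\<close>). The recursion therefore bounds each of \<open>\<bar>x (n + 1)\<bar>\<close> and
  \<open>\<bar>H (n + 1)\<bar>\<close> by the other, plus a constant, plus \<open>\<epsilon>\<close> times the convolution of \<open>\<bar>k\<bar>\<close>
  with \<open>\<bar>x\<bar>\<close>.

  The factor \<open>1 + \<eta>\<close> pays for the last two terms. The right-hand side is written as a convex
  combination in which \<open>(1 + \<eta>) * b\<close>, where \<open>b\<close> is the leading term, has weight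
  \<open>1 / (1 + \<eta>)\<close>. The rest of the unit mass is shared between the constant and the convolution,
  whose total mass is at most \<open>\<epsilon> * (\<Sum>j. \<bar>k j\<bar>)\<close> and so fits once \<open>\<epsilon>\<close> is small. Since \<open>\<phi>\<close> is
  increasing and convex, it can be applied to both sides and moved inside the combination
  (\<open>convex_perturbed_convolution\<close>).

  Summing over \<open>n\<close> and exchanging the order of summation turns the convolution into at most
  \<open>\<mu>\<close> times the partial sums of \<open>\<phi> \<bar>x j\<bar>\<close>, where \<open>\<mu> < 1/2\<close> is the mass left to it
  (\<open>sum_phi_perturbed_convolution\<close>). In part (i) this multiple is absorbed into the left-hand
  side; in part (ii) it is bounded by the hypothesis, as \<open>\<phi>\<close> is increasing. In both parts
  finiteness of the upper mean is used in the form of an affine bound on the partial sums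
  (\<open>limsup_mean_finite_iff\<close>).
\<close>

section \<open>Finite upper means\<close>

text \<open>
  Only finitely many partial sums escape the bound that the limit superior provides, and these
  go into the constant \<open>A\<close>.
\<close>

lemma limsup_mean_finite_iff:
  fixes S :: "nat \<Rightarrow> real"
  shows "limsup (\<lambda>n. ereal (1 / real n * S n)) < \<infinity> \<longleftrightarrow> (\<exists>A B. \<forall>n. S n \<le> A + B * real n)"
proof
  assume "limsup (\<lambda>n. ereal (1 / real n * S n)) < \<infinity>"
  then obtain B where "limsup (\<lambda>n. ereal (1 / real n * S n)) < ereal B"
    by (metis ereal_dense2)
  then have "\<forall>\<^sub>F n in sequentially. ereal (1 / real n * S n) < ereal B"
    by (rule Limsup_lessD)
  then obtain n0 where n0: "\<And>n. n \<ge> n0 \<Longrightarrow> 1 / real n * S n < B"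
    by (auto simp: eventually_sequentially)
  have "S n \<le> (\<Sum>i\<le>n0. \<bar>S i\<bar>) + \<bar>B\<bar> * real n" for n
  proof (cases "n \<le> n0")
    case True
    then have "\<bar>S n\<bar> \<le> (\<Sum>i\<le>n0. \<bar>S i\<bar>)"
      by (intro member_le_sum) auto
    then show ?thesis
      using mult_nonneg_nonneg[of "\<bar>B\<bar>" "real n"] by linarith
  next
    case False
    then have "S n \<le> B * real n"
      using n0[of n] by (simp add: field_simps)
    also have "\<dots> \<le> \<bar>B\<bar> * real n"
      by (intro mult_right_mono) auto
    finally show ?thesis
      by (simp add: add_increasing sum_nonneg)
  qed
  then show "\<exists>A B. \<forall>n. S n \<le> A + B * real n" by blast
next
  assume "\<exists>A B. \<forall>n. S n \<le> A + B * real n"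
  then obtain A B where AB: "\<And>n. S n \<le> A + B * real n" by blast
  have "1 / real n * S n \<le> \<bar>A\<bar> + \<bar>B\<bar>" for n
  proof (cases "n = 0")
    case False
    have "A \<le> \<bar>A\<bar> * real n"
      using False mult_left_mono[of 1 "real n" "\<bar>A\<bar>"] by simp
    moreover have "B * real n \<le> \<bar>B\<bar> * real n"
      by (intro mult_right_mono) auto
    ultimately have "S n \<le> \<bar>A\<bar> * real n + \<bar>B\<bar> * real n"
      using AB[of n] by linarith
    then show ?thesis
      using False by (simp add: field_simps)
  qed simp
  then have "limsup (\<lambda>n. ereal (1 / real n * S n)) \<le> ereal (\<bar>A\<bar> + \<bar>B\<bar>)"
    by (intro Limsup_bounded always_eventually allI) (simp only: ereal_less_eq)
  then show "limsup (\<lambda>n. ereal (1 / real n * S n)) < \<infinity>"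
    by (rule order.strict_trans1) simp
qed

section \<open>Sublinear functions\<close>

lemma sublinear_affine_bound:
  fixes f :: "real \<Rightarrow> real"
  assumes cont: "continuous_on UNIV f"
    and lim: "((\<lambda>t. f t / t) \<longlongrightarrow> 0) at_infinity"
    and eps: "\<epsilon> > 0"
  obtains M where "M \<ge> 0" "\<And>t. \<bar>f t\<bar> \<le> M + \<epsilon> * \<bar>t\<bar>"
proof -
  obtain R where R: "\<And>t. R \<le> \<bar>t\<bar> \<Longrightarrow> \<bar>f t / t\<bar> < \<epsilon>"
    using tendstoD[OF lim eps] by (auto simp: eventually_at_infinity)
  have "bounded (f ` cball 0 R)"
    by (intro compact_imp_bounded compact_continuous_image continuous_on_subset[OF cont]) auto
  then obtain M where M: "M > 0" "\<And>t. t \<in> cball 0 R \<Longrightarrow> \<bar>f t\<bar> \<le> M"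
    by (auto simp: bounded_pos)
  have "\<bar>f t\<bar> \<le> (M + \<bar>f 0\<bar>) + \<epsilon> * \<bar>t\<bar>" for t
  proof (cases "t = 0 \<or> \<bar>t\<bar> \<le> R")
    case True
    then have "\<bar>f t\<bar> \<le> M + \<bar>f 0\<bar>"
      using M(1) M(2)[of t] by auto
    then show ?thesis
      using eps mult_nonneg_nonneg[of \<epsilon> "\<bar>t\<bar>"] by linarith
  next
    case False
    then have "\<bar>f t\<bar> \<le> \<epsilon> * \<bar>t\<bar>"
      using R[of t] by (simp add: abs_divide field_simps)
    then show ?thesis using M(1) by simp
  qed
  then show thesis using M(1) by (intro that[of "M + \<bar>f 0\<bar>"]) auto
qed

section \<open>Jensen's inequality and convolutions\<close>

text \<open>
  This is Jensen's inequality after placing the missing mass at the origin. Its contribution is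
  bounded by \<open>\<phi> 0\<close>, since \<open>\<phi>\<close> is nonnegative there.
\<close>

lemma convex_on_sub_probability:
  fixes \<phi> :: "real \<Rightarrow> real"
  assumes conv: "convex_on {0..} \<phi>" and zero: "\<phi> 0 \<ge> 0" and fin: "finite I"
    and w: "\<And>i. i \<in> I \<Longrightarrow> w i \<ge> 0" and y: "\<And>i. i \<in> I \<Longrightarrow> y i \<ge> 0"
    and mass: "sum w I \<le> 1"
  shows "\<phi> (\<Sum>i\<in>I. w i * y i) \<le> \<phi> 0 + (\<Sum>i\<in>I. w i * \<phi> (y i))"
proof -
  define J where "J = insert None (Some ` I)"
  define v where "v = case_option (1 - sum w I) w"
  define z where "z = case_option 0 y"
  have J_sum: "sum g J = g None + (\<Sum>i\<in>I. g (Some i))" for g :: "'a option \<Rightarrow> real"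
    unfolding J_def using fin by (subst sum.insert) (auto simp: sum.reindex)
  have "\<phi> (\<Sum>i\<in>J. v i *\<^sub>R z i) \<le> (\<Sum>i\<in>J. v i * \<phi> (z i))"
    by (rule convex_on_sum[OF _ _ conv]; (subst J_sum)?)
       (use fin w y mass in \<open>auto simp: J_def v_def z_def\<close>)
  then have "\<phi> (\<Sum>i\<in>I. w i * y i) \<le> (1 - sum w I) * \<phi> 0 + (\<Sum>i\<in>I. w i * \<phi> (y i))"
    by (simp add: J_sum v_def z_def)
  moreover have "(1 - sum w I) * \<phi> 0 \<le> \<phi> 0"
    using zero mass sum_nonneg[of I w] w by (intro mult_left_le_one_le) auto
  ultimately show ?thesis by linarith
qed

text \<open>
  The unit mass is split as \<open>1 / (1 + \<eta>) + \<mu> + \<mu>\<close>. The parts go to \<open>(1 + \<eta>) * b\<close>, to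
  \<open>C / \<mu>\<close>, and to the weighted sum rescaled by \<open>1 / \<mu>\<close>.
\<close>

lemma convex_perturbed_convolution:
  fixes \<phi> :: "real \<Rightarrow> real"
  assumes nonneg: "\<And>t. t \<ge> 0 \<Longrightarrow> \<phi> t \<ge> 0"
    and mono: "mono_on {0..} \<phi>" and conv: "convex_on {0..} \<phi>"
    and eta: "\<eta> > 0" and mu: "\<mu> = (1 - 1 / (1 + \<eta>)) / 2"
    and fin: "finite I"
    and w: "\<And>i. i \<in> I \<Longrightarrow> w i \<ge> 0" and y: "\<And>i. i \<in> I \<Longrightarrow> y i \<ge> 0"
    and mass: "sum w I \<le> \<mu>"
    and "a \<ge> 0" "b \<ge> 0" "C \<ge> 0"
    and le: "a \<le> b + C + (\<Sum>i\<in>I. w i * y i)"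
  shows "\<phi> a \<le> \<phi> ((1 + \<eta>) * b) + \<phi> (C / \<mu>) + \<phi> 0 + (\<Sum>i\<in>I. w i * \<phi> (y i))"
proof -
  define \<rho> where "\<rho> = 1 / (1 + \<eta>)"
  define z where "z = (\<Sum>i\<in>I. (w i / \<mu>) * y i)"
  have lam: "0 < \<rho>" "\<rho> < 1" "\<rho> * ((1 + \<eta>) * b) = b"
    using eta by (auto simp: \<rho>_def field_simps)
  have mu': "2 * \<mu> = 1 - \<rho>" "\<mu> > 0" "\<mu> \<le> 1"
  proof -
    show "2 * \<mu> = 1 - \<rho>" using mu by (simp add: \<rho>_def)
    then show "\<mu> > 0" "\<mu> \<le> 1" using lam by linarith+
  qed
  have z: "z \<ge> 0" "\<mu> * z = (\<Sum>i\<in>I. w i * y i)"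
    using w y mu'(2) by (auto simp: z_def sum_distrib_left intro!: sum_nonneg)
  define m where "m = (1/2) * (C / \<mu>) + (1/2) * z"
  have m: "m \<ge> 0" "(1 - \<rho>) * m = C + (\<Sum>i\<in>I. w i * y i)"
    using z(1) mu'(2) \<open>C \<ge> 0\<close> by (auto simp: m_def field_simps simp flip: mu'(1) z(2))
  have "\<phi> a \<le> \<phi> (\<rho> * ((1 + \<eta>) * b) + (1 - \<rho>) * m)"
    unfolding lam(3) m(2) using le \<open>a \<ge> 0\<close> by (intro mono_onD[OF mono]) auto
  also have "\<dots> \<le> \<rho> * \<phi> ((1 + \<eta>) * b) + (1 - \<rho>) * \<phi> m"
    using convex_onD[OF conv, of "1 - \<rho>" "(1 + \<eta>) * b" m] lam(1,2) m(1) eta \<open>b \<ge> 0\<close> by simp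
  also have "\<phi> m \<le> (1/2) * \<phi> (C / \<mu>) + (1/2) * \<phi> z"
    using convex_onD[OF conv, of "1/2" "C / \<mu>" z] z(1) mu'(2) \<open>C \<ge> 0\<close> by (simp add: m_def)
  also have "\<phi> z \<le> \<phi> 0 + (\<Sum>i\<in>I. (w i / \<mu>) * \<phi> (y i))"
    unfolding z_def using mass mu'(2) w y
    by (intro convex_on_sub_probability[OF conv nonneg fin])
       (auto simp: sum_divide_distrib[symmetric])
  finally have "\<phi> a \<le> \<rho> * \<phi> ((1 + \<eta>) * b)
      + (1 - \<rho>) * ((1/2) * \<phi> (C / \<mu>) + (1/2) * (\<phi> 0 + (\<Sum>i\<in>I. (w i / \<mu>) * \<phi> (y i))))"
    using lam by (simp add: mult_left_mono)
  also have "\<dots> = \<rho> * \<phi> ((1 + \<eta>) * b) + \<mu> * \<phi> (C / \<mu>) + \<mu> * \<phi> 0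
      + (\<Sum>i\<in>I. w i * \<phi> (y i))"
    using mu'(2) by (simp add: sum_distrib_left algebra_simps flip: mu'(1))
  also have "\<dots> \<le> \<phi> ((1 + \<eta>) * b) + \<phi> (C / \<mu>) + \<phi> 0 + (\<Sum>i\<in>I. w i * \<phi> (y i))"
    using lam mu' eta \<open>b \<ge> 0\<close> \<open>C \<ge> 0\<close>
    by (intro add_mono mult_left_le_one_le nonneg) auto
  finally show ?thesis .
qed

lemma sum_convolution_le:
  fixes w g :: "nat \<Rightarrow> real"
  assumes w: "\<And>i. w i \<ge> 0" "summable w" and g: "\<And>i. g i \<ge> 0"
  shows "(\<Sum>n<N. \<Sum>j\<le>n. w (n - j) * g j) \<le> suminf w * (\<Sum>j<N. g j)"
proof -
  have "(\<Sum>n<N. \<Sum>j\<le>n. w (n - j) * g j) = (\<Sum>j<N. \<Sum>n=j..<N. w (n - j) * g j)"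
    by (induction N) (auto simp: sum.distrib simp flip: lessThan_Suc_atMost)
  also have "\<dots> \<le> (\<Sum>j<N. suminf w * g j)"
  proof (rule sum_mono)
    fix j assume "j \<in> {..<N}"
    have "(\<Sum>n=j..<N. w (n - j)) = (\<Sum>i<N - j. w i)"
      by (rule sum.reindex_bij_witness[of _ "\<lambda>i. i + j" "\<lambda>n. n - j"]) auto
    also have "\<dots> \<le> suminf w"
      using w by (intro sum_le_suminf) auto
    finally show "(\<Sum>n=j..<N. w (n - j) * g j) \<le> suminf w * g j"
      using g by (simp add: mult_right_mono flip: sum_distrib_right)
  qed
  finally show ?thesis by (simp add: sum_distrib_left)
qed

text \<open>
  Here \<open>a\<close> and \<open>b\<close> stand for \<open>\<bar>x\<bar>\<close> and \<open>\<bar>H\<bar>\<close> in either order, and \<open>y\<close> for \<open>\<bar>x\<bar>\<close>. As \<open>\<mu> < 1/2\<close>,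
  the multiple of the sums of \<open>\<phi> (y j)\<close> on the right can be absorbed when \<open>y = a\<close>.
\<close>

lemma sum_phi_perturbed_convolution:
  fixes \<phi> :: "real \<Rightarrow> real" and a b y w :: "nat \<Rightarrow> real"
  assumes nonneg: "\<And>t. t \<ge> 0 \<Longrightarrow> \<phi> t \<ge> 0"
    and mono: "mono_on {0..} \<phi>" and conv: "convex_on {0..} \<phi>"
    and eta: "\<eta> > 0" and mu: "\<mu> = (1 - 1 / (1 + \<eta>)) / 2"
    and w: "\<And>i. w i \<ge> 0" "summable w" "suminf w \<le> \<mu>"
    and nn: "\<And>i. a i \<ge> 0" "\<And>i. b i \<ge> 0" "\<And>i. y i \<ge> 0" "C \<ge> 0"
    and le: "\<And>n. a (Suc n) \<le> b (Suc n) + C + (\<Sum>j\<le>n. w (n - j) * y j)"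
  shows "(\<Sum>j=1..N. \<phi> (a j)) \<le> (\<Sum>j=1..N. \<phi> ((1 + \<eta>) * b j))
           + (\<phi> (C / \<mu>) + \<phi> 0) * real N + \<mu> * (\<Sum>j<N. \<phi> (y j))"
proof -
  have shift: "(\<Sum>j=1..N. g j) = (\<Sum>n<N. g (Suc n))" for g :: "nat \<Rightarrow> real"
    by (simp add: sum.atLeast1_atMost_eq)
  have step: "\<phi> (a (Suc n)) \<le> \<phi> ((1 + \<eta>) * b (Suc n)) + \<phi> (C / \<mu>) + \<phi> 0
      + (\<Sum>j\<le>n. w (n - j) * \<phi> (y j))" for n
  proof (rule convex_perturbed_convolution[OF nonneg mono conv eta mu])
    have "(\<Sum>j\<le>n. w (n - j)) = (\<Sum>j\<le>n. w j)"
      by (rule sum.reindex_bij_witness[of _ "\<lambda>j. n - j" "\<lambda>j. n - j"]) auto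
    also have "\<dots> \<le> suminf w"
      using w by (intro sum_le_suminf) auto
    finally show "(\<Sum>j\<le>n. w (n - j)) \<le> \<mu>" using w(3) by simp
  qed (use w nn le in auto)
  have "(\<Sum>n<N. \<phi> (a (Suc n))) \<le> (\<Sum>n<N. \<phi> ((1 + \<eta>) * b (Suc n)) + \<phi> (C / \<mu>) + \<phi> 0
      + (\<Sum>j\<le>n. w (n - j) * \<phi> (y j)))"
    by (intro sum_mono step)
  also have "\<dots> = (\<Sum>n<N. \<phi> ((1 + \<eta>) * b (Suc n))) + (\<phi> (C / \<mu>) + \<phi> 0) * real N
      + (\<Sum>n<N. \<Sum>j\<le>n. w (n - j) * \<phi> (y j))"
    by (simp add: sum.distrib algebra_simps)
  also have "(\<Sum>n<N. \<Sum>j\<le>n. w (n - j) * \<phi> (y j)) \<le> suminf w * (\<Sum>j<N. \<phi> (y j))"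
    by (intro sum_convolution_le w nonneg nn)
  also have "\<dots> \<le> \<mu> * (\<Sum>j<N. \<phi> (y j))"
    by (intro mult_right_mono w sum_nonneg nonneg nn)
  finally show ?thesis by (simp only: shift)
qed

section \<open>Mean bounds for the Volterra equation\<close>

text \<open>
  Moving the convolution term of the recursion to either side bounds \<open>x\<close> by \<open>H\<close> and \<open>H\<close> by \<open>x\<close>
  with the same perturbation, whose kernel has total mass as small as desired.
\<close>

lemma volterra_mutual_bounds:
  fixes f :: "real \<Rightarrow> real" and k H x :: "nat \<Rightarrow> real"
  assumes f_cont: "continuous_on UNIV f"
    and f_sublinear: "((\<lambda>t. f t / t) \<longlongrightarrow> 0) at_infinity"
    and k_summable: "summable (\<lambda>j. \<bar>k j\<bar>)"
    and x_Suc: "\<And>n. x (n + 1) = H (n + 1) + (\<Sum>j=0..n. k (n - j) * f (x j))"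
    and mu: "\<mu> > 0"
  obtains w C where "\<And>i. w i \<ge> 0" "summable w" "suminf w \<le> \<mu>" "C \<ge> 0"
    "\<And>n. \<bar>x (Suc n)\<bar> \<le> \<bar>H (Suc n)\<bar> + C + (\<Sum>j\<le>n. w (n - j) * \<bar>x j\<bar>)"
    "\<And>n. \<bar>H (Suc n)\<bar> \<le> \<bar>x (Suc n)\<bar> + C + (\<Sum>j\<le>n. w (n - j) * \<bar>x j\<bar>)"
proof -
  define K where "K = (\<Sum>j. \<bar>k j\<bar>)"
  have K: "K \<ge> 0"
    unfolding K_def using k_summable by (intro suminf_nonneg) auto
  \<comment> \<open>The kernel may vanish, so \<open>\<mu>\<close> is divided by \<open>K + 1\<close> and not by \<open>K\<close>.\<close>
  define \<epsilon> where "\<epsilon> = \<mu> / (K + 1)"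
  have eps: "\<epsilon> > 0" "\<epsilon> * K \<le> \<mu>"
    using mu K by (auto simp: \<epsilon>_def field_simps)
  obtain M where M: "M \<ge> 0" "\<And>t. \<bar>f t\<bar> \<le> M + \<epsilon> * \<bar>t\<bar>"
    using sublinear_affine_bound[OF f_cont f_sublinear eps(1)] by blast
  define w where "w = (\<lambda>j. \<epsilon> * \<bar>k j\<bar>)"
  have conv: "\<bar>\<Sum>j=0..n. k (n - j) * f (x j)\<bar> \<le> K * M + (\<Sum>j\<le>n. w (n - j) * \<bar>x j\<bar>)" for n
  proof -
    have "\<bar>\<Sum>j=0..n. k (n - j) * f (x j)\<bar> \<le> (\<Sum>j\<le>n. \<bar>k (n - j)\<bar> * \<bar>f (x j)\<bar>)"
      unfolding atLeast0AtMost abs_mult[symmetric] by (rule sum_abs)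
    also have "\<dots> \<le> (\<Sum>j\<le>n. \<bar>k (n - j)\<bar> * (M + \<epsilon> * \<bar>x j\<bar>))"
      by (intro sum_mono mult_left_mono M) auto
    also have "\<dots> = (\<Sum>j\<le>n. \<bar>k (n - j)\<bar>) * M + (\<Sum>j\<le>n. w (n - j) * \<bar>x j\<bar>)"
      by (simp add: w_def sum.distrib sum_distrib_left algebra_simps)
    also have "(\<Sum>j\<le>n. \<bar>k (n - j)\<bar>) = (\<Sum>j\<le>n. \<bar>k j\<bar>)"
      by (rule sum.reindex_bij_witness[of _ "\<lambda>j. n - j" "\<lambda>j. n - j"]) auto
    also have "(\<Sum>j\<le>n. \<bar>k j\<bar>) * M \<le> K * M"
      unfolding K_def using k_summable M(1) by (intro mult_right_mono sum_le_suminf) auto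
    finally show ?thesis by simp
  qed
  show thesis
  proof
    show "w i \<ge> 0" for i using eps by (simp add: w_def)
    show "summable w" using k_summable by (simp add: w_def summable_mult)
    show "suminf w \<le> \<mu>"
      using eps(2) k_summable by (simp add: w_def K_def suminf_mult)
    show "K * M \<ge> 0" using K M(1) by simp
    show "\<bar>x (Suc n)\<bar> \<le> \<bar>H (Suc n)\<bar> + K * M + (\<Sum>j\<le>n. w (n - j) * \<bar>x j\<bar>)" for n
      using conv[of n] x_Suc[of n] by simp
    show "\<bar>H (Suc n)\<bar> \<le> \<bar>x (Suc n)\<bar> + K * M + (\<Sum>j\<le>n. w (n - j) * \<bar>x j\<bar>)" for n
      using conv[of n] x_Suc[of n] by simp
  qed
qed

theorem theorem16:
  fixes f \<phi> :: "real \<Rightarrow> real" and k H x :: "nat \<Rightarrow> real" and \<xi> :: real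
  assumes f_cont: "continuous_on UNIV f"
    and f_sublinear: "((\<lambda>t. f t / t) \<longlongrightarrow> 0) at_infinity"
    and k_summable: "summable (\<lambda>j. \<bar>k j\<bar>)"
    and x_0: "x 0 = \<xi>"
    and x_Suc: "\<And>n. x (n + 1) = H (n + 1) + (\<Sum>j=0..n. k (n - j) * f (x j))"
    and phi_range: "\<phi> \<in> {0..} \<rightarrow> {0..}"
    and phi_mono: "mono_on {0..} \<phi>"
    and phi_convex: "convex_on {0..} \<phi>"
  shows "((\<exists>\<eta>>0. limsup (\<lambda>n. ereal (1 / real n * (\<Sum>j=1..n. \<phi> ((1 + \<eta>) * \<bar>H j\<bar>)))) < \<infinity>) \<longrightarrow>
          limsup (\<lambda>n. ereal (1 / real n * (\<Sum>j=0..n. \<phi> \<bar>x j\<bar>))) < \<infinity>) \<and>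
         ((\<exists>\<eta>>0. limsup (\<lambda>n. ereal (1 / real n * (\<Sum>j=0..n. \<phi> ((1 + \<eta>) * \<bar>x j\<bar>)))) < \<infinity>) \<longrightarrow>
          limsup (\<lambda>n. ereal (1 / real n * (\<Sum>j=1..n. \<phi> \<bar>H j\<bar>))) < \<infinity>)"
proof -
  have nonneg: "\<phi> t \<ge> 0" if "t \<ge> 0" for t
    using phi_range that by auto
  have part1: "limsup (\<lambda>n. ereal (1 / real n * (\<Sum>j=0..n. \<phi> \<bar>x j\<bar>))) < \<infinity>"
    if eta: "\<eta> > 0"
      and H_mean: "limsup (\<lambda>n. ereal (1 / real n * (\<Sum>j=1..n. \<phi> ((1 + \<eta>) * \<bar>H j\<bar>)))) < \<infinity>" for \<eta>
  proof -
    define \<mu> where "\<mu> = (1 - 1 / (1 + \<eta>)) / 2"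
    have mu: "\<mu> > 0" "\<mu> < 1/2" using eta by (auto simp: \<mu>_def field_simps)
    obtain w C where w: "\<And>i. w i \<ge> 0" "summable w" "suminf w \<le> \<mu>" and C: "C \<ge> 0"
      and le: "\<And>n. \<bar>x (Suc n)\<bar> \<le> \<bar>H (Suc n)\<bar> + C + (\<Sum>j\<le>n. w (n - j) * \<bar>x j\<bar>)"
      using volterra_mutual_bounds[OF f_cont f_sublinear k_summable x_Suc mu(1)] by metis
    obtain A B where AB: "\<And>n. (\<Sum>j=1..n. \<phi> ((1 + \<eta>) * \<bar>H j\<bar>)) \<le> A + B * real n"
      using H_mean unfolding limsup_mean_finite_iff by blast
    define D where "D = \<phi> (C / \<mu>) + \<phi> 0"
    have "(\<Sum>j=0..n. \<phi> \<bar>x j\<bar>) \<le> 2 * (\<phi> \<bar>x 0\<bar> + A) + (2 * (B + D)) * real n" for n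
    proof -
      define S where "S = (\<Sum>j=0..n. \<phi> \<bar>x j\<bar>)"
      have S: "S = \<phi> \<bar>x 0\<bar> + (\<Sum>j=1..n. \<phi> \<bar>x j\<bar>)"
        by (simp add: S_def sum.atLeast_Suc_atMost)
      have "(\<Sum>j=1..n. \<phi> \<bar>x j\<bar>) \<le> (\<Sum>j=1..n. \<phi> ((1 + \<eta>) * \<bar>H j\<bar>))
           + D * real n + \<mu> * (\<Sum>j<n. \<phi> \<bar>x j\<bar>)"
        unfolding D_def
        by (rule sum_phi_perturbed_convolution[OF nonneg phi_mono phi_convex eta \<mu>_def w])
           (use C le in auto)
      moreover have "\<mu> * (\<Sum>j<n. \<phi> \<bar>x j\<bar>) \<le> (1/2) * S"
        unfolding S_def using mu
        by (intro mult_mono sum_mono2 sum_nonneg nonneg) auto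
      ultimately show ?thesis
        using AB[of n] S unfolding S_def[symmetric] by (simp add: algebra_simps)
    qed
    then show ?thesis unfolding limsup_mean_finite_iff by blast
  qed
  have part2: "limsup (\<lambda>n. ereal (1 / real n * (\<Sum>j=1..n. \<phi> \<bar>H j\<bar>))) < \<infinity>"
    if eta: "\<eta> > 0"
      and x_mean: "limsup (\<lambda>n. ereal (1 / real n * (\<Sum>j=0..n. \<phi> ((1 + \<eta>) * \<bar>x j\<bar>)))) < \<infinity>" for \<eta>
  proof -
    define \<mu> where "\<mu> = (1 - 1 / (1 + \<eta>)) / 2"
    have mu: "\<mu> > 0" "\<mu> < 1/2" using eta by (auto simp: \<mu>_def field_simps)
    obtain w C where w: "\<And>i. w i \<ge> 0" "summable w" "suminf w \<le> \<mu>" and C: "C \<ge> 0"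
      and le: "\<And>n. \<bar>H (Suc n)\<bar> \<le> \<bar>x (Suc n)\<bar> + C + (\<Sum>j\<le>n. w (n - j) * \<bar>x j\<bar>)"
      using volterra_mutual_bounds[OF f_cont f_sublinear k_summable x_Suc mu(1)] by metis
    obtain A B where AB: "\<And>n. (\<Sum>j=0..n. \<phi> ((1 + \<eta>) * \<bar>x j\<bar>)) \<le> A + B * real n"
      using x_mean unfolding limsup_mean_finite_iff by blast
    define D where "D = \<phi> (C / \<mu>) + \<phi> 0"
    have "(\<Sum>j=1..n. \<phi> \<bar>H j\<bar>) \<le> 2 * A + (2 * B + D) * real n" for n
    proof -
      define T where "T = (\<Sum>j=0..n. \<phi> ((1 + \<eta>) * \<bar>x j\<bar>))"
      have nn: "\<phi> ((1 + \<eta>) * \<bar>x j\<bar>) \<ge> 0" for j using eta by (intro nonneg) auto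
      have "(\<Sum>j=1..n. \<phi> \<bar>H j\<bar>) \<le> (\<Sum>j=1..n. \<phi> ((1 + \<eta>) * \<bar>x j\<bar>))
           + D * real n + \<mu> * (\<Sum>j<n. \<phi> \<bar>x j\<bar>)"
        unfolding D_def
        by (rule sum_phi_perturbed_convolution[OF nonneg phi_mono phi_convex eta \<mu>_def w])
           (use C le in auto)
      moreover have "(\<Sum>j=1..n. \<phi> ((1 + \<eta>) * \<bar>x j\<bar>)) \<le> T"
        unfolding T_def using nn by (intro sum_mono2) auto
      moreover have "\<mu> * (\<Sum>j<n. \<phi> \<bar>x j\<bar>) \<le> 1 * T"
      proof (rule mult_mono)
        have "(\<Sum>j<n. \<phi> \<bar>x j\<bar>) \<le> (\<Sum>j<n. \<phi> ((1 + \<eta>) * \<bar>x j\<bar>))"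
          using eta by (intro sum_mono mono_onD[OF phi_mono]) (auto simp: algebra_simps)
        also have "\<dots> \<le> T"
          unfolding T_def using nn by (intro sum_mono2) auto
        finally show "(\<Sum>j<n. \<phi> \<bar>x j\<bar>) \<le> T" .
      qed (use mu in \<open>auto intro!: sum_nonneg nonneg\<close>)
      ultimately show ?thesis
        using AB[of n] unfolding T_def[symmetric] by (simp add: algebra_simps)
    qed
    then show ?thesis unfolding limsup_mean_finite_iff by blast
  qed
  show ?thesis using part1 part2 by blast
qed

end
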